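(* Let $d=d(n)$ be a positive integer-valued function of $n$ with $d=O(\log n)$, and put $\lambda=d^2+d$. Let $\pi\in\mathfrak{S}_n$ be chosen uniformly at random. Then \[ \Pr{d(\pi)\geq d+2}=e^{-\lambda}+O\!\left(\frac{(\log n)^6e^{\lambda}}{n}\right) \] as $n\to\infty$.
   Context: $[n]=\{1,\dots,n\}$ and $\mathfrak{S}_n$ is the set of permutations of $[n]$. For $\pi\in\mathfrak{S}_n$ ($n\ge 2$), the minimum Manhattan distance is $d(\pi)=\min_{1\le i<j\le n}\big(|i-j|+|\pi(i)-\pi(j)|\big)$ (the minimum $L^1$ distance between two distinct points of the graph $\{(i,\pi(i))\}$ of $\pi$). *)

theory Defs
  imports "HOL-Combinatorics.Permutations" "HOL-Library.Landau_Symbols" Complex_Main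
begin

text \<open>Minimum Manhattan distance between two distinct points (i, p i), (j, p j)
  of the graph of a permutation p of {1..n} (meaningful for n \<ge> 2).\<close>
definition min_manhattan :: "nat \<Rightarrow> (nat \<Rightarrow> nat) \<Rightarrow> nat" where
  "min_manhattan n p =
     Min {nat \<bar>int i - int j\<bar> + nat \<bar>int (p i) - int (p j)\<bar> | i j.
            i \<in> {1..n} \<and> j \<in> {1..n} \<and> i < j}"

end

theory Submission
  imports Defs
begin

text \<open>
  Let W p be the number of pairs of points of the graph of p at Manhattan distance at most d + 1;
  the event in question is W = 0. Chen-Stein: if g solves
  l g(w+1) - w g(w) = [w = 0] - exp(-l) for l = E W, then P(W = 0) - exp(-l) is a sum, over the possible
  close pairs (i, a), (j, b), of P(p i = a, p j = b) times the difference between E g(W + 1) and the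
  conditional expectation of g(W) given p i = a and p j = b. The conditional law is realised by composing
  p with two transpositions of values, which moves only four points; unless one of these lies
  near another point, an event of probability O(d^2/n), W increases by exactly 1. As
  0 \<le> g \<le> 1 and l = d^2 + d + O(d^3/n), the total error is O(d^4/n).
\<close>

section \<open>Stein's equation for the Poisson law and the coupling bound\<close>

lemma stein_equation_zero:
  fixes l :: real
  assumes l: "l \<ge> 0"
  obtains g :: "nat \<Rightarrow> real" where "\<And>w. 0 \<le> g w" "\<And>w. g w \<le> 1"
    "\<And>w. l * g (Suc w) - real w * g w = of_bool (w = 0) - exp (- l)"
proof -
  \<comment> \<open>The solution is \<open>g (w + 1) = \<integral>\<^sub>0\<^sup>1 t ^ w * exp (- l * t) dt\<close>, expanded as a series.\<close>
  define a where "a = (\<lambda>w m. l ^ m * fact w / fact (m + Suc w) :: real)"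
  \<comment> \<open>The value at 0 is free, since it enters the equation only as
    \<open>0 * g 0\<close>; the choice 0 respects both bounds.\<close>
  define g where "g = (\<lambda>j. case j of 0 \<Rightarrow> 0 | Suc w \<Rightarrow> exp (- l) * (\<Sum>m. a w m))"
  have a0: "0 \<le> a w m" for w m
    using l by (simp add: a_def)
  have exps: "(\<lambda>m. l ^ m / fact m) sums exp l"
    using exp_converges[of l] by (simp add: field_simps scaleR_conv_of_real)
  have fact_le: "(fact w * fact m :: real) \<le> fact (m + Suc w)" for w m
  proof -
    have "(fact w * fact m :: nat) \<le> fact (w + m)"
      by (rule dvd_imp_le[OF fact_fact_dvd_fact]) simp
    also have "\<dots> \<le> fact (m + Suc w)" by (rule fact_mono) simp
    finally have "real (fact w * fact m) \<le> real (fact (m + Suc w))"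
      by (rule of_nat_mono)
    then show ?thesis by (simp del: fact_Suc add_Suc_right)
  qed
  \<comment> \<open>Comparison with the exponential series gives summability; its sum
    \<open>exp l\<close> cancels against the factor \<open>exp (- l)\<close> in \<open>g\<close>,
    whence \<open>g w \<le> 1\<close>.\<close>
  have a1: "a w m \<le> l ^ m / fact m" for w m
  proof -
    have "l ^ m * (fact w * fact m) \<le> l ^ m * fact (m + Suc w)"
      using l fact_le by (intro mult_left_mono) auto
    then show ?thesis
      unfolding a_def by (subst divide_le_eq) (auto simp: field_simps simp del: fact_Suc)
  qed
  have sa: "summable (a w)" for w
    by (rule summable_comparison_test'[OF sums_summable[OF exps], of 0])
       (use a0 a1 in auto)
  have sum_le: "(\<Sum>m. a w m) \<le> exp l" for w
    using suminf_le[OF a1 sa sums_summable[OF exps]] sums_unique[OF exps] by simp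
  have g0: "0 \<le> g w" for w
    by (cases w) (auto simp: g_def suminf_nonneg[OF sa a0])
  have g1: "g w \<le> 1" for w
  proof (cases w)
    case (Suc v)
    have "exp (- l) * (\<Sum>m. a v m) \<le> exp (- l) * exp l"
      by (rule mult_left_mono[OF sum_le]) simp
    then show ?thesis by (simp add: g_def Suc exp_minus)
  qed (simp add: g_def)
  have rec: "l * g (Suc w) - real w * g w = of_bool (w = 0) - exp (- l)" for w
  proof -
    \<comment> \<open>One series read in two ways: without its first term 1 it is \<open>l\<close>
      times the series \<open>a w\<close> behind \<open>g (Suc w)\<close>; as a whole it is
      \<open>w\<close> times the series behind \<open>g w\<close> if \<open>w > 0\<close>, and the
      exponential series if \<open>w = 0\<close>.\<close>
    define s where "s = (\<lambda>m. l ^ m * fact w / fact (m + w) :: real)"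
    have s_Suc: "s (Suc m) = l * a w m" for m
      by (simp add: s_def a_def)
    have "(\<lambda>m. s (Suc m)) sums (l * (\<Sum>m. a w m))"
      unfolding s_Suc by (intro sums_mult summable_sums sa)
    then have *: "s sums (l * (\<Sum>m. a w m) + s 0)"
      by (simp add: sums_Suc_iff)
    have s00: "s 0 = 1" by (simp add: s_def)
    show ?thesis
    proof (cases w)
      case 0
      have "s = (\<lambda>m. l ^ m / fact m)" by (simp add: s_def 0)
      then have "l * (\<Sum>m. a w m) + 1 = exp l"
        using * exps s00 sums_unique2 by metis
      then have "exp (- l) * (l * (\<Sum>m. a w m)) = exp (- l) * (exp l - 1)"
        by simp
      then show ?thesis
        by (simp add: g_def 0 algebra_simps exp_minus)
    next
      case (Suc v)
      have "s = (\<lambda>m. real w * a v m)"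
        by (simp add: s_def a_def Suc field_simps del: of_nat_Suc)
      moreover have "(\<lambda>m. real w * a v m) sums (real w * (\<Sum>m. a v m))"
        by (intro sums_mult summable_sums sa)
      ultimately have "l * (\<Sum>m. a w m) + 1 = real w * (\<Sum>m. a v m)"
        using * s00 sums_unique2 by metis
      then have "exp (- l) * (l * (\<Sum>m. a w m)) = exp (- l) * (real w * (\<Sum>m. a v m) - 1)"
        by simp
      then show ?thesis
        by (simp add: g_def Suc algebra_simps)
    qed
  qed
  show ?thesis by (rule that[OF g0 g1 rec])
qed

text \<open>Counts replace probabilities. For uniform \<open>p\<close> each event
  \<open>M \<alpha>\<close> has probability \<open>1 / c\<close> (take \<open>f\<close> constant),
  so \<open>card A / c\<close> is the mean of \<open>W\<close>, and the hypothesis on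
  \<open>T\<close> says that \<open>T \<alpha> p\<close> has the law of \<open>p\<close> conditioned
  on \<open>M \<alpha>\<close>. Summing the Stein equation over \<Omega> leaves the differences
  \<open>g (Suc (W p)) - g (W (T \<alpha> p))\<close>; they vanish where the coupling adds exactly 1
  and are at most 1 in absolute value elsewhere.\<close>

lemma chen_stein_coupling:
  fixes A :: "'a set" and \<Omega> :: "'p set" and M :: "'a \<Rightarrow> 'p set" and W :: "'p \<Rightarrow> nat"
    and T :: "'a \<Rightarrow> 'p \<Rightarrow> 'p" and c B :: real
  assumes fin: "finite \<Omega>" "finite A" and c: "c > 0"
    and W: "\<And>p. p \<in> \<Omega> \<Longrightarrow> W p = card {\<alpha> \<in> A. p \<in> M \<alpha>}"
    and T: "\<And>\<alpha> f. \<alpha> \<in> A \<Longrightarrow> (\<Sum>p\<in>\<Omega>. f (T \<alpha> p)) = c * (\<Sum>p\<in>\<Omega> \<inter> M \<alpha>. f p :: real)"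
    and B: "\<And>\<alpha>. \<alpha> \<in> A \<Longrightarrow> real (card {p \<in> \<Omega>. W (T \<alpha> p) \<noteq> Suc (W p)}) \<le> B"
  shows "\<bar>real (card {p \<in> \<Omega>. W p = 0}) - real (card \<Omega>) * exp (- (real (card A) / c))\<bar>
           \<le> real (card A) / c * B"
proof -
  define l where "l = real (card A) / c"
  have "l \<ge> 0" using c by (simp add: l_def)
  then obtain g where g: "\<And>w. 0 \<le> g w" "\<And>w. g w \<le> 1"
    "\<And>w. l * g (Suc w) - real w * g w = of_bool (w = 0) - exp (- l)"
    using stein_equation_zero by blast
  have "(\<Sum>p\<in>\<Omega>. real (W p) * g (W p)) = (\<Sum>p\<in>\<Omega>. \<Sum>\<alpha>\<in>A. if p \<in> M \<alpha> then g (W p) else 0)"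
    using fin by (intro sum.cong refl) (simp add: W sum.If_cases Int_def)
  also have "\<dots> = (\<Sum>\<alpha>\<in>A. \<Sum>p\<in>\<Omega>. if p \<in> M \<alpha> then g (W p) else 0)"
    by (rule sum.swap)
  also have "\<dots> = (\<Sum>\<alpha>\<in>A. \<Sum>p\<in>\<Omega> \<inter> M \<alpha>. g (W p))"
    using fin by (simp add: sum.inter_restrict)
  \<comment> \<open>The coupling turns a sum over \<open>M \<alpha>\<close> into one over all of
    \<Omega>, comparable term by term with the other half of the Stein equation.\<close>
  also have "\<dots> = (\<Sum>\<alpha>\<in>A. (\<Sum>p\<in>\<Omega>. g (W (T \<alpha> p))) / c)"
  proof (rule sum.cong[OF refl])
    fix \<alpha> assume "\<alpha> \<in> A"
    then show "(\<Sum>p\<in>\<Omega> \<inter> M \<alpha>. g (W p)) = (\<Sum>p\<in>\<Omega>. g (W (T \<alpha> p))) / c"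
      using T[of \<alpha> "\<lambda>p. g (W p)"] c by simp
  qed
  finally have 1: "(\<Sum>p\<in>\<Omega>. real (W p) * g (W p)) = (\<Sum>\<alpha>\<in>A. (\<Sum>p\<in>\<Omega>. g (W (T \<alpha> p))) / c)" .
  have 2: "l * (\<Sum>p\<in>\<Omega>. g (Suc (W p))) = (\<Sum>\<alpha>\<in>A. (\<Sum>p\<in>\<Omega>. g (Suc (W p))) / c)"
    by (simp add: l_def)
  have "real (card {p \<in> \<Omega>. W p = 0}) - real (card \<Omega>) * exp (- l)
      = (\<Sum>p\<in>\<Omega>. of_bool (W p = 0) - exp (- l))"
    using fin by (simp add: sum_subtractf of_bool_def sum.If_cases Int_def)
  also have "\<dots> = (\<Sum>p\<in>\<Omega>. l * g (Suc (W p)) - real (W p) * g (W p))"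
    by (simp only: g(3))
  also have "\<dots> = l * (\<Sum>p\<in>\<Omega>. g (Suc (W p))) - (\<Sum>p\<in>\<Omega>. real (W p) * g (W p))"
    by (simp add: sum_subtractf sum_distrib_left)
  also have "\<dots> = (\<Sum>\<alpha>\<in>A. (\<Sum>p\<in>\<Omega>. g (Suc (W p)) - g (W (T \<alpha> p))) / c)"
    unfolding 1 2 by (simp add: sum_subtractf diff_divide_distrib)
  also have "\<bar>\<dots>\<bar> \<le> (\<Sum>\<alpha>\<in>A. B / c)"
  proof (rule order_trans[OF sum_abs sum_mono])
    fix \<alpha> assume \<alpha>: "\<alpha> \<in> A"
    have "\<bar>\<Sum>p\<in>\<Omega>. g (Suc (W p)) - g (W (T \<alpha> p))\<bar>
        \<le> (\<Sum>p\<in>\<Omega>. of_bool (W (T \<alpha> p) \<noteq> Suc (W p)))"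
    proof (rule order_trans[OF sum_abs sum_mono])
      fix p
      show "\<bar>g (Suc (W p)) - g (W (T \<alpha> p))\<bar> \<le> of_bool (W (T \<alpha> p) \<noteq> Suc (W p))"
        using g(1)[of "Suc (W p)"] g(2)[of "Suc (W p)"] g(1)[of "W (T \<alpha> p)"] g(2)[of "W (T \<alpha> p)"]
        by (cases "W (T \<alpha> p) = Suc (W p)") auto
    qed
    also have "\<dots> = real (card {p \<in> \<Omega>. W (T \<alpha> p) \<noteq> Suc (W p)})"
      using fin by (simp add: of_bool_def sum.If_cases Int_def Collect_neg_eq[symmetric] del: of_bool_not_iff)
    also have "\<dots> \<le> B" by (rule B[OF \<alpha>])
    finally show "\<bar>(\<Sum>p\<in>\<Omega>. g (Suc (W p)) - g (W (T \<alpha> p))) / c\<bar> \<le> B / c"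
      using c by (simp add: divide_right_mono)
  qed
  finally show ?thesis by (simp add: l_def)
qed

section \<open>Permutations with prescribed values\<close>

text \<open>Composing with the inverse of one such permutation \<open>p0\<close> maps all of them
  injectively to permutations that fix \<open>X\<close> pointwise.\<close>

lemma card_permutes_agree_le:
  assumes S: "finite S" and X: "X \<subseteq> S"
  shows "card {p. p permutes S \<and> (\<forall>x\<in>X. p x = f x)} \<le> fact (card S - card X)"
proof (cases "{p. p permutes S \<and> (\<forall>x\<in>X. p x = f x)} = {}")
  case False
  then obtain p0 where p0: "p0 permutes S" "\<And>x. x \<in> X \<Longrightarrow> p0 x = f x" by blast
  have fX: "finite X" using S X finite_subset by blast
  have "card {p. p permutes S \<and> (\<forall>x\<in>X. p x = f x)} \<le> card {p. p permutes (S - X)}"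
  proof (rule card_inj_on_le)
    show "inj_on (\<lambda>p. inv p0 \<circ> p) {p. p permutes S \<and> (\<forall>x\<in>X. p x = f x)}"
      by (rule inj_onI) (metis comp_assoc id_comp permutes_inv_o(1)[OF p0(1)])
    show "(\<lambda>p. inv p0 \<circ> p) ` {p. p permutes S \<and> (\<forall>x\<in>X. p x = f x)} \<subseteq> {p. p permutes (S - X)}"
    proof safe
      fix p assume p: "p permutes S" "\<forall>x\<in>X. p x = f x"
      have "inv p0 \<circ> p permutes S"
        by (rule permutes_compose[OF p(1) permutes_inv[OF p0(1)]])
      moreover have "(inv p0 \<circ> p) x = x" if "x \<in> X" for x
        using p(2) p0(2) that permutes_inverses(2)[OF p0(1)] by (metis comp_apply)
      ultimately show "inv p0 \<circ> p permutes (S - X)"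
        by (rule permutes_superset) auto
    qed
    show "finite {p. p permutes (S - X)}" using S by (simp add: finite_permutations)
  qed
  also have "\<dots> = fact (card S - card X)"
    using S X fX by (simp add: card_permutations card_Diff_subset)
  finally show ?thesis .
qed (metis card.empty le0)

text \<open>This is the coupling hypothesis with \<open>c = n * (n - 1)\<close>. Group the
  permutations by the pair \<open>(p i, p j)\<close>: on each of the \<open>n * (n - 1)\<close>
  classes \<open>T\<close> is left composition with one fixed permutation, hence a bijection onto
  the permutations with \<open>p i = a\<close> and \<open>p j = b\<close>.\<close>

lemma sum_permutes_prescribe_two:
  fixes f :: "('a \<Rightarrow> 'a) \<Rightarrow> real"
  assumes S: "finite S" and ij: "i \<in> S" "j \<in> S" "i \<noteq> j" and ab: "a \<in> S" "b \<in> S" "a \<noteq> b"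
  defines "T \<equiv> \<lambda>p. transpose b (transpose a (p i) (p j)) \<circ> transpose a (p i) \<circ> p"
  shows "(\<Sum>p | p permutes S. f (T p)) =
    real (card S * (card S - 1)) * (\<Sum>p\<in>{p. p permutes S} \<inter> {p. p i = a \<and> p j = b}. f p)"
proof -
  let ?D = "SIGMA u:S. S - {u}"
  let ?R = "{p. p permutes S} \<inter> {p. p i = a \<and> p j = b}"
  have cD: "card ?D = card S * (card S - 1)"
    using S by (subst card_SigmaI) (auto simp: card_Diff_singleton)
  have "(\<Sum>p | p permutes S. f (T p)) =
      (\<Sum>y\<in>?D. \<Sum>p\<in>{p \<in> {p. p permutes S}. (p i, p j) = y}. f (T p))"
  proof (rule sum.group[symmetric])
    show "(\<lambda>p. (p i, p j)) ` {p. p permutes S} \<subseteq> ?D"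
      using ij by (auto simp: permutes_in_image dest: permutes_inj injD)
  qed (use S in \<open>auto simp: finite_permutations\<close>)
  also have "\<dots> = (\<Sum>y\<in>?D. \<Sum>p\<in>?R. f p)"
  proof (rule sum.cong[OF refl])
    fix y assume "y \<in> ?D"
    then obtain u v where y: "y = (u, v)" and uv: "u \<in> S" "v \<in> S" "u \<noteq> v" by auto
    \<comment> \<open>The first transposition takes \<open>u\<close> to \<open>a\<close> and, as
      \<open>u \<noteq> v\<close>, takes \<open>v\<close> to something other than \<open>a\<close>;
      the second moves that value to \<open>b\<close> and leaves \<open>a\<close> alone because
      \<open>a \<noteq> b\<close>.\<close>
    define s where "s = transpose b (transpose a u v) \<circ> transpose a u"
    have s: "s permutes S"
      unfolding s_def using ab uv
      by (intro permutes_compose permutes_swap_id) (auto simp: transpose_def)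
    have su: "s u = a" "s v = b"
      using ab uv by (auto simp: s_def transpose_def)
    have su': "inv s a = u" "inv s b = v"
      using su permutes_inverses(2)[OF s] by metis+
    show "(\<Sum>p\<in>{p \<in> {p. p permutes S}. (p i, p j) = y}. f (T p)) = (\<Sum>p\<in>?R. f p)"
    proof (rule sum.reindex_bij_witness[where i = "\<lambda>q. inv s \<circ> q" and j = "\<lambda>p. s \<circ> p"])
      fix p assume "p \<in> {p \<in> {p. p permutes S}. (p i, p j) = y}"
      then have p: "p permutes S" "p i = u" "p j = v" by (auto simp: y)
      show "inv s \<circ> (s \<circ> p) = p"
        using permutes_inv_o(2)[OF s] by (simp add: comp_assoc[symmetric])
      show "s \<circ> p \<in> ?R"
        using p su s by (auto intro: permutes_compose)
      show "f (s \<circ> p) = f (T p)"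
        by (simp add: T_def s_def p comp_assoc)
    next
      fix q assume "q \<in> ?R"
      then have q: "q permutes S" "q i = a" "q j = b" by auto
      show "s \<circ> (inv s \<circ> q) = q"
        using permutes_inv_o(1)[OF s] by (simp add: comp_assoc[symmetric])
      show "inv s \<circ> q \<in> {p \<in> {p. p permutes S}. (p i, p j) = y}"
        using q su' by (auto simp: y intro: permutes_compose permutes_inv[OF s])
    qed
  qed
  also have "\<dots> = real (card S * (card S - 1)) * (\<Sum>p\<in>?R. f p)"
    by (simp add: cD)
  finally show ?thesis .
qed

section \<open>Close pairs and the quadruples that index them\<close>

text \<open>Serves for positions and for values. The radius is \<open>d\<close> and not
  \<open>d + 1\<close>: two distinct points of a permutation graph differ in both coordinates, so at
  distance at most \<open>d + 1\<close> each coordinate differs by at most \<open>d\<close>.\<close>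

definition nbhd :: "nat \<Rightarrow> nat \<Rightarrow> nat \<Rightarrow> nat set" where
  "nbhd n d x = {y \<in> {1..n}. \<bar>int y - int x\<bar> \<le> int d}"

definition close_pairs :: "nat \<Rightarrow> nat \<Rightarrow> (nat \<Rightarrow> nat) \<Rightarrow> (nat \<times> nat) set" where
  "close_pairs n d p = {(x, y). x \<in> {1..n} \<and> y \<in> {1..n} \<and> x < y \<and>
     \<bar>int x - int y\<bar> + \<bar>int (p x) - int (p y)\<bar> \<le> int d + 1}"

text \<open>The index set of the Chen-Stein sum. Positions are ordered so that each pair of points
  occurs once; the values may then come in either order.\<close>

definition close_quads :: "nat \<Rightarrow> nat \<Rightarrow> (nat \<times> nat \<times> nat \<times> nat) set" where
  "close_quads n d = {(i, j, a, b). {i, j, a, b} \<subseteq> {1..n} \<and> i < j \<and> a \<noteq> b \<and>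
     \<bar>int i - int j\<bar> + \<bar>int a - int b\<bar> \<le> int d + 1}"

definition prescribe_two :: "nat \<Rightarrow> nat \<Rightarrow> nat \<Rightarrow> nat \<Rightarrow> (nat \<Rightarrow> nat) \<Rightarrow> nat \<Rightarrow> nat" where
  "prescribe_two i j a b p = transpose b (transpose a (p i) (p j)) \<circ> transpose a (p i) \<circ> p"

lemma finite_close_pairs: "finite (close_pairs n d p)"
  by (rule finite_subset[of _ "{1..n} \<times> {1..n}"]) (auto simp: close_pairs_def)

lemma finite_close_quads: "finite (close_quads n d)"
  by (rule finite_subset[of _ "{1..n} \<times> {1..n} \<times> {1..n} \<times> {1..n}"])
     (auto simp: close_quads_def)

lemma nbhd_subset: "nbhd n d x \<subseteq> {1..n}"
  by (auto simp: nbhd_def)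

lemma finite_nbhd: "finite (nbhd n d x)"
  by (rule finite_subset[OF nbhd_subset]) simp

lemma card_nbhd_le: "card (nbhd n d x) \<le> 2 * d + 1"
proof -
  have "card (nbhd n d x) \<le> card {x - d..x + d}"
    by (rule card_mono) (auto simp: nbhd_def)
  then show ?thesis by simp
qed

lemma card_Sigma_nbhd_le: "card (SIGMA x:{1..n}. nbhd n d x) \<le> n * (2 * d + 1)"
proof -
  have "card (SIGMA x:{1..n}. nbhd n d x) = (\<Sum>x\<in>{1..n}. card (nbhd n d x))"
    by (simp add: card_SigmaI finite_nbhd)
  also have "\<dots> \<le> (\<Sum>x\<in>{1..n}. 2 * d + 1)"
    by (intro sum_mono card_nbhd_le)
  finally show ?thesis by simp
qed

text \<open>With \<open>n \<ge> 2\<close> the set under \<open>Min\<close> is nonempty, so the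
  minimum is at least \<open>d + 2\<close> exactly if every distance is.\<close>

lemma close_pairs_empty_iff:
  assumes "n \<ge> 2"
  shows "close_pairs n d p = {} \<longleftrightarrow> min_manhattan n p \<ge> d + 2"
proof -
  let ?S = "{nat \<bar>int i - int j\<bar> + nat \<bar>int (p i) - int (p j)\<bar> | i j.
            i \<in> {1..n} \<and> j \<in> {1..n} \<and> i < j}"
  have "?S \<subseteq> (\<lambda>(i, j). nat \<bar>int i - int j\<bar> + nat \<bar>int (p i) - int (p j)\<bar>) ` ({1..n} \<times> {1..n})"
    by auto
  then have fin: "finite ?S"
    by (rule finite_subset) simp
  have "nat \<bar>int 1 - int 2\<bar> + nat \<bar>int (p 1) - int (p 2)\<bar> \<in> ?S"
    using assms by (intro CollectI exI[of _ 1] exI[of _ 2]) auto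
  then have ne: "?S \<noteq> {}" by blast
  have "min_manhattan n p \<ge> d + 2 \<longleftrightarrow> (\<forall>s\<in>?S. d + 2 \<le> s)"
    unfolding min_manhattan_def using fin ne by (rule Min_ge_iff)
  also have "\<dots> \<longleftrightarrow> close_pairs n d p = {}"
  proof
    assume *: "\<forall>s\<in>?S. d + 2 \<le> s"
    show "close_pairs n d p = {}"
    proof (rule equals0I, clarify)
      fix i j assume "(i, j) \<in> close_pairs n d p"
      then have ij: "i \<in> {1..n}" "j \<in> {1..n}" "i < j"
        "\<bar>int i - int j\<bar> + \<bar>int (p i) - int (p j)\<bar> \<le> int d + 1"
        by (auto simp: close_pairs_def)
      then have "nat \<bar>int i - int j\<bar> + nat \<bar>int (p i) - int (p j)\<bar> \<in> ?S" by blast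
      then have "d + 2 \<le> nat \<bar>int i - int j\<bar> + nat \<bar>int (p i) - int (p j)\<bar>"
        by (rule bspec[OF *])
      then show False using ij(4) by linarith
    qed
  next
    assume *: "close_pairs n d p = {}"
    show "\<forall>s\<in>?S. d + 2 \<le> s"
    proof
      fix s assume "s \<in> ?S"
      then obtain i j where s: "s = nat \<bar>int i - int j\<bar> + nat \<bar>int (p i) - int (p j)\<bar>"
        and ij: "i \<in> {1..n}" "j \<in> {1..n}" "i < j" by blast
      have "(i, j) \<notin> close_pairs n d p" using * by simp
      then have "\<not> \<bar>int i - int j\<bar> + \<bar>int (p i) - int (p j)\<bar> \<le> int d + 1"
        using ij by (simp add: close_pairs_def)
      then show "d + 2 \<le> s" unfolding s by linarith
    qed
  qed
  finally show ?thesis by blast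
qed

text \<open>The map from \<open>(x, y)\<close> to \<open>(x, y, p x, p y)\<close> is a bijection
  from the close pairs to the indices whose event occurs; this writes \<open>W\<close> as a sum of
  indicators.\<close>

lemma card_close_pairs:
  assumes p: "p permutes {1..n}"
  shows "card (close_pairs n d p) =
    card {\<alpha> \<in> close_quads n d. p \<in> (case \<alpha> of (i, j, a, b) \<Rightarrow> {p. p i = a \<and> p j = b})}"
proof -
  have "{\<alpha> \<in> close_quads n d. p \<in> (case \<alpha> of (i, j, a, b) \<Rightarrow> {p. p i = a \<and> p j = b})}
      = (\<lambda>(x, y). (x, y, p x, p y)) ` close_pairs n d p"
  proof (intro equalityI subsetI)
    fix \<alpha> assume "\<alpha> \<in> (\<lambda>(x, y). (x, y, p x, p y)) ` close_pairs n d p"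
    then obtain x y where \<alpha>: "\<alpha> = (x, y, p x, p y)" and xy: "(x, y) \<in> close_pairs n d p" by auto
    have "p x \<in> {1..n}" "p y \<in> {1..n}" "p x \<noteq> p y"
      using xy permutes_in_image[OF p] permutes_inj[OF p]
      by (auto simp: close_pairs_def simp del: atLeastAtMost_iff dest: injD)
    with xy show "\<alpha> \<in> {\<alpha> \<in> close_quads n d. p \<in> (case \<alpha> of (i, j, a, b) \<Rightarrow> {p. p i = a \<and> p j = b})}"
      by (auto simp: \<alpha> close_pairs_def close_quads_def)
  next
    fix \<alpha> assume *: "\<alpha> \<in> {\<alpha> \<in> close_quads n d. p \<in> (case \<alpha> of (i, j, a, b) \<Rightarrow> {p. p i = a \<and> p j = b})}"
    obtain x y a b where \<alpha>: "\<alpha> = (x, y, a, b)" by (cases \<alpha>)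
    with * have "\<alpha> = (x, y, p x, p y)" "(x, y) \<in> close_pairs n d p"
      by (auto simp: close_pairs_def close_quads_def)
    then show "\<alpha> \<in> (\<lambda>(x, y). (x, y, p x, p y)) ` close_pairs n d p"
      by (intro image_eqI[of _ _ "(x, y)"]) simp_all
  qed
  then show ?thesis
    by (simp add: card_image inj_on_def split_def prod_eq_iff)
qed

text \<open>A quadruple is given by the corner \<open>(i, min a b)\<close> of its bounding box, the
  side lengths \<open>(s, t)\<close> and the orientation \<open>a < b\<close>. With
  \<open>s, t \<ge> 1\<close> and \<open>s + t \<le> d + 1\<close> there are
  \<open>d ^ 2 + d\<close> shapes. At most \<open>n ^ 2\<close> corners are possible, and every
  corner with both coordinates at most \<open>n - d\<close> admits all shapes, as
  \<open>s, t \<le> d\<close>.\<close>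

lemma card_close_quads_bounds:
  shows "card (close_quads n d) \<le> n ^ 2 * (d ^ 2 + d)"
    and "(n - d) ^ 2 * (d ^ 2 + d) \<le> card (close_quads n d)"
proof -
  define O' where "O' = (SIGMA s:{1..d}. {1..d + 1 - s}) \<times> (UNIV :: bool set)"
  define h :: "(nat \<times> nat) \<times> (nat \<times> nat) \<times> bool \<Rightarrow> nat \<times> nat \<times> nat \<times> nat" where
    "h = (\<lambda>((i, m), (s, t), c). (i, i + s, if c then m else m + t, if c then m + t else m))"
  have "2 * (\<Sum>s\<in>{1..d}. d + 1 - s) = d ^ 2 + d"
  proof -
    have "(\<Sum>s\<in>{1..d}. d + 1 - s) = (\<Sum>s\<in>{1..d}. s)"
      by (rule sum.reindex_bij_witness[of _ "\<lambda>s. d + 1 - s" "\<lambda>s. d + 1 - s"]) auto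
    then show ?thesis
      using gauss_sum_from_Suc_0[of d, where 'a = nat] by (simp add: power2_eq_square algebra_simps)
  qed
  then have cO: "card O' = d ^ 2 + d"
    by (simp add: O'_def card_cartesian_product card_SigmaI)
  have fO: "finite O'" by (simp add: O'_def)
  have "close_quads n d \<subseteq> h ` (({1..n} \<times> {1..n}) \<times> O')"
  proof clarify
    fix i j a b assume "(i, j, a, b) \<in> close_quads n d"
    then have *: "i \<in> {1..n}" "j \<in> {1..n}" "a \<in> {1..n}" "b \<in> {1..n}" "i < j" "a \<noteq> b"
      "\<bar>int i - int j\<bar> + \<bar>int a - int b\<bar> \<le> int d + 1"
      by (auto simp: close_quads_def)
    then show "(i, j, a, b) \<in> h ` (({1..n} \<times> {1..n}) \<times> O')"
      by (intro image_eqI[of _ _ "((i, min a b), (j - i, max a b - min a b), a < b)"])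
         (auto simp: h_def O'_def)
  qed
  then have "card (close_quads n d) \<le> card (({1..n} \<times> {1..n}) \<times> O')"
    by (rule surj_card_le[rotated]) (simp add: fO)
  then show "card (close_quads n d) \<le> n ^ 2 * (d ^ 2 + d)"
    by (simp add: card_cartesian_product cO power2_eq_square)
  have "card (({1..n - d} \<times> {1..n - d}) \<times> O') \<le> card (close_quads n d)"
  proof (rule card_inj_on_le[of h])
    show "inj_on h (({1..n - d} \<times> {1..n - d}) \<times> O')"
      by (auto simp: inj_on_def h_def O'_def split: if_splits)
    show "h ` (({1..n - d} \<times> {1..n - d}) \<times> O') \<subseteq> close_quads n d"
      by (auto simp: h_def O'_def close_quads_def split: if_splits)
  qed (rule finite_close_quads)
  then show "(n - d) ^ 2 * (d ^ 2 + d) \<le> card (close_quads n d)"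
    by (simp add: card_cartesian_product cO power2_eq_square)
qed

section \<open>Effect of the coupling on the number of close pairs\<close>

text \<open>
  With k and l the positions of the values a and b, both p and the modified permutation map
  {i, j, k, l} onto {a, b, p i, p j}. The hypotheses say that no position near {i, j, k, l} carries a value near
  {a, b, p i, p j}, apart from the obvious coincidences, so only the pair (i, j) can change its status.
\<close>
lemma card_close_pairs_prescribe_two:
  assumes p: "p permutes {1..n}" and q: "(i, j, a, b) \<in> close_quads n d"
    and E1: "\<And>m c x. m \<in> {i, j} \<Longrightarrow> c \<in> {a, b} \<Longrightarrow> x \<in> nbhd n d m \<Longrightarrow> p x \<notin> nbhd n d c"
    and E2: "\<And>m m' x. m \<in> {i, j} \<Longrightarrow> m' \<in> {i, j} \<Longrightarrow> x \<in> nbhd n d m \<Longrightarrow> x \<noteq> m' \<Longrightarrow>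
       p x \<notin> nbhd n d (p m')"
    and E3: "\<And>c c' k x. c \<in> {a, b} \<Longrightarrow> c' \<in> {a, b} \<Longrightarrow> k \<in> {1..n} \<Longrightarrow> p k = c \<Longrightarrow>
       x \<in> nbhd n d k \<Longrightarrow> x \<noteq> k \<Longrightarrow> p x \<notin> nbhd n d c'"
    and E4: "\<And>c m' k x. c \<in> {a, b} \<Longrightarrow> m' \<in> {i, j} \<Longrightarrow> k \<in> {1..n} \<Longrightarrow> p k = c \<Longrightarrow>
       x \<in> nbhd n d k \<Longrightarrow> x \<noteq> k \<Longrightarrow> x \<noteq> m' \<Longrightarrow> k \<noteq> m' \<Longrightarrow> p x \<notin> nbhd n d (p m')"
  shows "card (close_pairs n d (prescribe_two i j a b p)) = Suc (card (close_pairs n d p))"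
proof -
  define t where "t = prescribe_two i j a b p"
  define cl where "cl = (\<lambda>(r :: nat \<Rightarrow> nat) x y. \<bar>int x - int y\<bar> + \<bar>int (r x) - int (r y)\<bar> \<le> int d + 1)"
  have cl_sym: "cl r x y \<longleftrightarrow> cl r y x" for r x y
    by (auto simp: cl_def)
  have q': "i \<in> {1..n}" "j \<in> {1..n}" "a \<in> {1..n}" "b \<in> {1..n}" "i < j" "a \<noteq> b"
    "\<bar>int i - int j\<bar> + \<bar>int a - int b\<bar> \<le> int d + 1"
    using q by (auto simp: close_quads_def)
  have inj: "p x = p y \<longleftrightarrow> x = y" for x y
    using permutes_inj[OF p] by (auto dest: injD)
  have img: "p x \<in> {1..n} \<longleftrightarrow> x \<in> {1..n}" for x
    by (rule permutes_in_image[OF p])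
  obtain k l where kl: "p k = a" "p l = b"
    using permutes_surj[OF p] by (metis surj_def)
  have kl_in: "k \<in> {1..n}" "l \<in> {1..n}"
    using img kl q' by metis+
  have self: "x \<in> {1..n} \<Longrightarrow> x \<in> nbhd n d x" for x by (simp add: nbhd_def)
  \<comment> \<open>Otherwise \<open>E1\<close> would exclude the value \<open>p m\<close>, which is
    \<open>a\<close> or \<open>b\<close>, from its own window.\<close>
  have sep: "m \<notin> nbhd n d m'" if "m \<in> {k, l}" "m' \<in> {i, j}" for m m'
    using E1[of m' "p m" m] that kl q' self[of a] self[of b] by auto
  then have ne: "k \<noteq> i" "k \<noteq> j" "l \<noteq> i" "l \<noteq> j"
    using self q'(1,2) by auto
  have kl_ne: "k \<noteq> l" using kl q'(6) by auto
  have ne': "p i \<noteq> a" "p i \<noteq> b" "p j \<noteq> a" "p j \<noteq> b"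
    using ne kl inj by metis+
  have pij: "p i \<noteq> p j" using inj q'(5) by auto
  \<comment> \<open>As \<open>p j\<close> is neither \<open>a\<close> nor \<open>p i\<close>, the
    inner transposition fixes it, and the modification just swaps \<open>a\<close> with
    \<open>p i\<close> and \<open>b\<close> with \<open>p j\<close>.\<close>
  have t_eq: "t x = transpose b (p j) (transpose a (p i) (p x))" for x
    using ne' pij by (simp add: t_def prescribe_two_def)
  have t: "t i = a" "t j = b" "t k = p i" "t l = p j"
    using ne' ne'[symmetric] pij q'(6) by (simp_all add: t_eq kl)
  have t_other: "t x = p x" if "x \<notin> {i, j, k, l}" for x
  proof -
    have "p x \<noteq> p i" "p x \<noteq> p j" "p x \<noteq> a" "p x \<noteq> b"
      unfolding kl[symmetric] inj using that by auto
    then show ?thesis by (simp add: t_eq)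
  qed
  \<comment> \<open>Stated for a generic \<open>r\<close> so as to serve both \<open>p\<close> and
    \<open>t\<close>. A position in \<open>{i, j}\<close> is excluded by \<open>E1\<close> or
    \<open>E2\<close>, one in \<open>{k, l}\<close> by \<open>E3\<close> or \<open>E4\<close>,
    according to whether its value lies in \<open>{a, b}\<close> or in
    \<open>{p i, p j}\<close>.\<close>
  have far: "\<not> cl r x m" if x: "x \<in> {1..n}" "x \<notin> {i, j, k, l}" and m: "m \<in> {i, j, k, l}"
    and r: "r x = p x" "r m \<in> {a, b, p i, p j}" for r x m
  proof
    assume c: "cl r x m"
    have xm: "x \<noteq> m" "x \<noteq> i" "x \<noteq> j" using x(2) m by auto
    have "p x \<noteq> r m" using x(2) r(2) unfolding kl[symmetric] by (auto simp: inj)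
    then have near: "x \<in> nbhd n d m" "p x \<in> nbhd n d (r m)"
      using c x(1) img[of x] r(1) xm unfolding cl_def nbhd_def by auto
    have m': "(m \<in> {i, j} \<or> m \<in> {k, l}) \<and> (r m \<in> {a, b} \<or> r m = p i \<or> r m = p j)"
      using m r(2) by auto
    have mkl: "p m \<in> {a, b}" "m \<in> {1..n}" "m \<noteq> i" "m \<noteq> j" if "m \<in> {k, l}"
      using that kl kl_in ne by auto
    show False
    proof (cases "m \<in> {i, j}")
      case True
      then show False
        using E1[OF True _ near(1), of "r m"] E2[OF True _ near(1), of i] E2[OF True _ near(1), of j]
          near(2) m' xm by (metis insertI1 insertI2)
    next
      case False
      then have "m \<in> {k, l}" using m' by blast
      note mkl = mkl[OF this]
      show False
        using E3[OF mkl(1) _ mkl(2) refl near(1) xm(1), of "r m"]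
          E4[OF mkl(1) _ mkl(2) refl near(1) xm(1,2) mkl(3)]
          E4[OF mkl(1) _ mkl(2) refl near(1) xm(1,3) mkl(4)]
          near(2) m' by (metis insertI1 insertI2)
    qed
  qed
  have v_ij: "\<bar>int (p i) - int (p j)\<bar> > int d"
    using E2[of j i j] q' self[of j] img[of j] by (auto simp: nbhd_def)
  have v_kl: "\<bar>int k - int l\<bar> > int d"
  proof -
    have "l \<notin> nbhd n d k"
      using E3[of a b k l] kl kl_in(1) kl_ne q'(4) self[of b] by auto
    then show ?thesis using kl_in(2) by (auto simp: nbhd_def abs_minus_commute)
  qed
  have x_kl: "\<bar>int m - int m'\<bar> > int d" if "m \<in> {k, l}" "m' \<in> {i, j}" for m m'
  proof -
    have "m \<in> {1..n}" using that(1) kl_in by blast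
    then show ?thesis using sep[OF that] by (simp add: nbhd_def)
  qed
  \<comment> \<open>One coordinate differs by at least \<open>d + 1\<close> and the other by at
    least 1, so the distance is at least \<open>d + 2\<close>.\<close>
  have apart: "\<not> cl r x y"
    if "\<bar>int x - int y\<bar> > int d" "r x \<noteq> r y" for r x y
    using that by (auto simp: cl_def)
  have apart': "\<not> cl r x y"
    if "\<bar>int (r x) - int (r y)\<bar> > int d" "x \<noteq> y" for r x y
    using that by (auto simp: cl_def)
  have tij: "cl t i j" using q'(7) by (simp add: cl_def t)
  have nij: "\<not> cl p i j" using v_ij q'(5) by (intro apart') auto
  have pkl: "\<not> cl p k l" "\<not> cl t k l"
    using apart[OF v_kl, of p] apart[OF v_kl, of t] kl t pij q'(6) by simp_all
  have mixed: "\<not> cl p x y" "\<not> cl t x y" if "x \<in> {k, l}" "y \<in> {i, j}" for x y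
  proof -
    have "p x \<in> {a, b}" "t x \<in> {p i, p j}" "p y \<in> {p i, p j}" "t y \<in> {a, b}"
      using that kl t by blast+
    then have "p x \<noteq> p y" "t x \<noteq> t y" using ne' by auto
    then show "\<not> cl p x y" "\<not> cl t x y" by (auto simp: apart[OF x_kl[OF that]])
  qed
  \<comment> \<open>Two unmoved points keep their distance. A pair with at least one moved point is
    close neither before nor after, except that \<open>(i, j)\<close> becomes close.\<close>
  have key: "cl t x y \<longleftrightarrow> (x, y) = (i, j) \<or> cl p x y"
    if xy: "x \<in> {1..n}" "y \<in> {1..n}" "x < y" for x y
  proof -
    have tm: "t m \<in> {a, b, p i, p j}" "p m \<in> {a, b, p i, p j}" if "m \<in> {i, j, k, l}" for m
      using that t kl by auto
    consider "x \<notin> {i, j, k, l}" "y \<notin> {i, j, k, l}" | "x \<notin> {i, j, k, l}" "y \<in> {i, j, k, l}"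
      | "x \<in> {i, j, k, l}" "y \<notin> {i, j, k, l}" | "x \<in> {k, l}" "y \<in> {k, l}"
      | "x \<in> {k, l}" "y \<in> {i, j}" | "x \<in> {i, j}" "y \<in> {k, l}" | "x \<in> {i, j}" "y \<in> {i, j}"
      by blast
    then show ?thesis
    proof cases
      case 1
      then show ?thesis using t_other[of x] t_other[of y] by (auto simp: cl_def)
    next
      case 2
      then show ?thesis
        using far[of x y t] far[of x y p] tm[of y] t_other[of x] xy by auto
    next
      case 3
      then show ?thesis unfolding cl_sym[of t x y] cl_sym[of p x y]
        using far[of y x t] far[of y x p] tm[of x] t_other[of y] xy by auto
    next
      case 4
      then have "(x = k \<and> y = l) \<or> (x = l \<and> y = k)" using xy by auto
      then show ?thesis
        using pkl cl_sym[of t k l] cl_sym[of p k l] ne by auto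
    next
      case 5
      then show ?thesis using mixed[of x y] ne by auto
    next
      case 6
      then show ?thesis unfolding cl_sym[of t x y] cl_sym[of p x y]
        using mixed[of y x] ne by auto
    next
      case 7
      then show ?thesis using tij nij xy q'(5) by auto
    qed
  qed
  have "close_pairs n d r = {(x, y). x \<in> {1..n} \<and> y \<in> {1..n} \<and> x < y \<and> cl r x y}" for r
    by (simp add: close_pairs_def cl_def)
  then have "close_pairs n d t = insert (i, j) (close_pairs n d p)"
    using key q'(1,2,5) by auto
  moreover have "(i, j) \<notin> close_pairs n d p"
    using nij by (auto simp: close_pairs_def cl_def)
  ultimately show ?thesis
    unfolding t_def[symmetric] by (simp add: finite_close_pairs)
qed

section \<open>Counting the permutations for which the coupling fails\<close>

lemma card_UN_le_mult:
  assumes "finite I" "\<And>t. t \<in> I \<Longrightarrow> card (F t) \<le> b"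
  shows "card (\<Union>t\<in>I. F t) \<le> card I * b"
proof -
  have "card (\<Union>t\<in>I. F t) \<le> (\<Sum>t\<in>I. card (F t))"
    by (rule card_UN_le[OF assms(1)])
  also have "\<dots> \<le> card I * b"
    using sum_bounded_above[of I "\<lambda>t. card (F t)" b] assms(2) by simp
  finally show ?thesis .
qed

text \<open>Union bound over configurations \<open>t\<close>, each prescribing \<open>m\<close>
  values. The conditions on \<open>X t\<close> stand inside the existential so that \<open>I\<close>
  can be a plain product that also contains degenerate configurations, such as coinciding
  positions.\<close>

lemma card_permutes_cover_le:
  fixes X :: "'i \<Rightarrow> nat set"
  assumes fin: "finite I" and card_I: "card I \<le> N"
    and cover: "\<And>p. p \<in> E \<Longrightarrow> p permutes {1..n} \<and>
      (\<exists>t\<in>I. X t \<subseteq> {1..n} \<and> card (X t) = m \<and> (\<forall>x\<in>X t. p x = f t x))"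
  shows "card E \<le> N * fact (n - m)"
proof -
  let ?F = "\<lambda>t. {p. p permutes {1..n} \<and> X t \<subseteq> {1..n} \<and> card (X t) = m \<and> (\<forall>x\<in>X t. p x = f t x)}"
  have "finite (\<Union>t\<in>I. ?F t)"
    by (rule finite_subset[OF _ finite_permutations[of "{1..n}"]]) auto
  moreover have "E \<subseteq> (\<Union>t\<in>I. ?F t)"
    using cover by fast
  ultimately have "card E \<le> card (\<Union>t\<in>I. ?F t)"
    by (rule card_mono)
  also have "\<dots> \<le> card I * fact (n - m)"
  proof (rule card_UN_le_mult[OF fin])
    fix t
    show "card (?F t) \<le> fact (n - m)"
    proof (cases "X t \<subseteq> {1..n} \<and> card (X t) = m")
      case True
      then show ?thesis
        using card_permutes_agree_le[of "{1..n}" "X t" "f t"] by simp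
    next
      case False
      then have "?F t = {}" by blast
      then show ?thesis by (metis card.empty le0)
    qed
  qed
  also have "\<dots> \<le> N * fact (n - m)" using card_I by simp
  finally show ?thesis .
qed

text \<open>One prescribed value; its position and the value itself each range over a window. In
  this and the next three counts, every further prescribed value comes with one free coordinate, so
  the extra factor \<open>n\<close> is offset by the smaller factorial.\<close>

lemma card_nbhd_to_nbhd_le:
  shows "card {p. p permutes {1..n} \<and> (\<exists>x\<in>nbhd n d m. p x \<in> nbhd n d c)}
           \<le> (2 * d + 1) ^ 2 * fact (n - 1)"
proof -
  define I where "I = nbhd n d m \<times> nbhd n d c"
  define X :: "(nat \<times> nat) \<Rightarrow> nat set" where "X = (\<lambda>(x, v). {x})"
  define f :: "(nat \<times> nat) \<Rightarrow> nat \<Rightarrow> nat" where "f = (\<lambda>(x, v). \<lambda>y. v)"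
  have "card I \<le> (2 * d + 1) * (2 * d + 1)"
    unfolding I_def card_cartesian_product
    by (intro mult_mono card_nbhd_le card_Sigma_nbhd_le) auto
  then have "card I \<le> (2 * d + 1) ^ 2"
    by (simp only: power2_eq_square mult_ac)
  moreover have "finite I" by (auto simp: I_def finite_nbhd)
  moreover have "p permutes {1..n} \<and>
      (\<exists>t\<in>I. X t \<subseteq> {1..n} \<and> card (X t) = 1 \<and> (\<forall>y\<in>X t. p y = f t y))"
    if "p \<in> {p. p permutes {1..n} \<and> (\<exists>x\<in>nbhd n d m. p x \<in> nbhd n d c)}" for p
  proof -
    from that obtain x where p: "p permutes {1..n}" and x: "x \<in> nbhd n d m" "p x \<in> nbhd n d c" by blast
    have "x \<in> {1..n}" using x nbhd_subset by blast
    note pm = this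
    show ?thesis
    proof (intro conjI bexI[of _ "(x, p x)"])
      show "(x, p x) \<in> I" using x pm by (simp add: I_def)
    qed (use p x pm in \<open>auto simp: X_def f_def\<close>)
  qed
  ultimately show ?thesis
    by (intro card_permutes_cover_le[where X = X and f = f]) auto
qed

text \<open>Two prescribed values, at \<open>x\<close> and \<open>m'\<close>; the free coordinate is
  \<open>u = p m'\<close>.\<close>

lemma card_nbhd_to_nbhd_image_le:
  assumes m': "m' \<in> {1..n}"
  shows "card {p. p permutes {1..n} \<and> (\<exists>x\<in>nbhd n d m. x \<noteq> m' \<and> p x \<in> nbhd n d (p m'))}
           \<le> ((2 * d + 1) ^ 2 * n) * fact (n - 2)"
proof -
  define I where "I = nbhd n d m \<times> (SIGMA u:{1..n}. nbhd n d u)"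
  define X :: "(nat \<times> nat \<times> nat) \<Rightarrow> nat set" where "X = (\<lambda>(x, u, v). {x, m'})"
  define f :: "(nat \<times> nat \<times> nat) \<Rightarrow> nat \<Rightarrow> nat" where "f = (\<lambda>(x, u, v). \<lambda>y. if y = x then v else u)"
  have "card I \<le> (2 * d + 1) * (n * (2 * d + 1))"
    unfolding I_def card_cartesian_product
    by (intro mult_mono card_nbhd_le card_Sigma_nbhd_le) auto
  then have "card I \<le> ((2 * d + 1) ^ 2 * n)"
    by (simp only: power2_eq_square mult_ac)
  moreover have "finite I" by (auto simp: I_def finite_nbhd)
  moreover have "p permutes {1..n} \<and>
      (\<exists>t\<in>I. X t \<subseteq> {1..n} \<and> card (X t) = 2 \<and> (\<forall>y\<in>X t. p y = f t y))"
    if "p \<in> {p. p permutes {1..n} \<and> (\<exists>x\<in>nbhd n d m. x \<noteq> m' \<and> p x \<in> nbhd n d (p m'))}" for p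
  proof -
    from that obtain x where p: "p permutes {1..n}"
      and x: "x \<in> nbhd n d m" "x \<noteq> m'" "p x \<in> nbhd n d (p m')" by blast
    have "x \<in> {1..n}" using x nbhd_subset by blast
    moreover have "p m' \<in> {1..n}" using permutes_in_image[OF p] m' by blast
    ultimately have pm: "x \<in> {1..n}" "p m' \<in> {1..n}" by auto
    show ?thesis
    proof (intro conjI bexI[of _ "(x, p m', p x)"])
      show "(x, p m', p x) \<in> I" using x pm m' by (simp add: I_def)
    qed (use p x pm m' in \<open>auto simp: X_def f_def\<close>)
  qed
  ultimately show ?thesis
    by (intro card_permutes_cover_le[where X = X and f = f]) auto
qed

text \<open>Two prescribed values, at \<open>k\<close> and \<open>x\<close>; the free coordinate is
  the position \<open>k\<close> of the value \<open>c\<close>.\<close>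

lemma card_nbhd_preimage_to_nbhd_le:
  shows "card {p. p permutes {1..n} \<and> (\<exists>k\<in>{1..n}. \<exists>x\<in>nbhd n d k. p k = c \<and> x \<noteq> k \<and> p x \<in> nbhd n d c')}
           \<le> ((2 * d + 1) ^ 2 * n) * fact (n - 2)"
proof -
  define I where "I = (SIGMA u:{1..n}. nbhd n d u) \<times> nbhd n d c'"
  define X :: "((nat \<times> nat) \<times> nat) \<Rightarrow> nat set" where "X = (\<lambda>((k, x), v). {k, x})"
  define f :: "((nat \<times> nat) \<times> nat) \<Rightarrow> nat \<Rightarrow> nat" where "f = (\<lambda>((k, x), v). \<lambda>y. if y = x then v else c)"
  have "card I \<le> (n * (2 * d + 1)) * (2 * d + 1)"
    unfolding I_def card_cartesian_product
    by (intro mult_mono card_nbhd_le card_Sigma_nbhd_le) auto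
  then have "card I \<le> ((2 * d + 1) ^ 2 * n)"
    by (simp only: power2_eq_square mult_ac)
  moreover have "finite I" by (auto simp: I_def finite_nbhd)
  moreover have "p permutes {1..n} \<and>
      (\<exists>t\<in>I. X t \<subseteq> {1..n} \<and> card (X t) = 2 \<and> (\<forall>y\<in>X t. p y = f t y))"
    if "p \<in> {p. p permutes {1..n} \<and> (\<exists>k\<in>{1..n}. \<exists>x\<in>nbhd n d k. p k = c \<and> x \<noteq> k \<and> p x \<in> nbhd n d c')}" for p
  proof -
    from that obtain k x where p: "p permutes {1..n}" and k: "k \<in> {1..n}" "p k = c"
      and x: "x \<in> nbhd n d k" "x \<noteq> k" "p x \<in> nbhd n d c'" by blast
    have "x \<in> {1..n}" using x nbhd_subset by blast
    note pm = this
    show ?thesis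
    proof (intro conjI bexI[of _ "((k, x), p x)"])
      show "((k, x), p x) \<in> I" using x pm k by (simp add: I_def)
    qed (use p x pm k in \<open>auto simp: X_def f_def\<close>)
  qed
  ultimately show ?thesis
    by (intro card_permutes_cover_le[where X = X and f = f]) auto
qed

text \<open>Three prescribed values, at the distinct positions \<open>k\<close>, \<open>x\<close>
  and \<open>m'\<close>; both \<open>k\<close> and \<open>u = p m'\<close> are free.\<close>

lemma card_nbhd_preimage_to_nbhd_image_le:
  assumes m': "m' \<in> {1..n}"
  shows "card {p. p permutes {1..n} \<and> (\<exists>k\<in>{1..n}. \<exists>x\<in>nbhd n d k. p k = c \<and> x \<noteq> k \<and> x \<noteq> m' \<and> k \<noteq> m' \<and> p x \<in> nbhd n d (p m'))}
           \<le> ((2 * d + 1) ^ 2 * n ^ 2) * fact (n - 3)"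
proof -
  define I where "I = (SIGMA u:{1..n}. nbhd n d u) \<times> (SIGMA u:{1..n}. nbhd n d u)"
  define X :: "((nat \<times> nat) \<times> (nat \<times> nat)) \<Rightarrow> nat set" where "X = (\<lambda>((k, x), (u, v)). {k, x, m'})"
  define f :: "((nat \<times> nat) \<times> (nat \<times> nat)) \<Rightarrow> nat \<Rightarrow> nat" where "f = (\<lambda>((k, x), (u, v)). \<lambda>y. if y = x then v else if y = k then c else u)"
  have "card I \<le> (n * (2 * d + 1)) * (n * (2 * d + 1))"
    unfolding I_def card_cartesian_product
    by (intro mult_mono card_nbhd_le card_Sigma_nbhd_le) auto
  then have "card I \<le> ((2 * d + 1) ^ 2 * n ^ 2)"
    by (simp only: power2_eq_square mult_ac)
  moreover have "finite I" by (auto simp: I_def finite_nbhd)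
  moreover have "p permutes {1..n} \<and>
      (\<exists>t\<in>I. X t \<subseteq> {1..n} \<and> card (X t) = 3 \<and> (\<forall>y\<in>X t. p y = f t y))"
    if "p \<in> {p. p permutes {1..n} \<and> (\<exists>k\<in>{1..n}. \<exists>x\<in>nbhd n d k. p k = c \<and> x \<noteq> k \<and> x \<noteq> m' \<and> k \<noteq> m' \<and> p x \<in> nbhd n d (p m'))}" for p
  proof -
    from that obtain k x where p: "p permutes {1..n}" and k: "k \<in> {1..n}" "p k = c"
      and x: "x \<in> nbhd n d k" "x \<noteq> k" "x \<noteq> m'" "k \<noteq> m'" "p x \<in> nbhd n d (p m')" by blast
    have "x \<in> {1..n}" using x nbhd_subset by blast
    moreover have "p m' \<in> {1..n}" using permutes_in_image[OF p] m' by blast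
    ultimately have pm: "x \<in> {1..n}" "p m' \<in> {1..n}" by auto
    show ?thesis
    proof (intro conjI bexI[of _ "((k, x), (p m', p x))"])
      show "((k, x), (p m', p x)) \<in> I" using x pm k m' by (simp add: I_def)
    qed (use p x pm k m' in \<open>auto simp: X_def f_def\<close>)
  qed
  ultimately show ?thesis
    by (intro card_permutes_cover_le[where X = X and f = f]) auto
qed

text \<open>A permutation for which the coupling fails violates one of the four separation
  hypotheses. Each has 4 choices of its parameters, and the four bounds are 1, 2, 2 and 4 times
  \<open>(2 * d + 1) ^ 2 * fact (n - 1)\<close>, so the constant is 4 * (1 + 2 + 2 + 4) =
  36.\<close>

lemma card_prescribe_two_bad_le:
  assumes n: "n \<ge> 4" and q: "(i, j, a, b) \<in> close_quads n d"
  shows "card {p. p permutes {1..n} \<and>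
      card (close_pairs n d (prescribe_two i j a b p)) \<noteq> Suc (card (close_pairs n d p))}
    \<le> 36 * (2 * d + 1) ^ 2 * fact (n - 1)"
proof -
  define E1 where "E1 = (\<lambda>m c. {p. p permutes {1..n} \<and> (\<exists>x\<in>nbhd n d m. p x \<in> nbhd n d c)})"
  define E2 where "E2 = (\<lambda>m m'. {p. p permutes {1..n} \<and>
    (\<exists>x\<in>nbhd n d m. x \<noteq> m' \<and> p x \<in> nbhd n d (p m'))})"
  define E3 where "E3 = (\<lambda>c c'. {p. p permutes {1..n} \<and>
    (\<exists>k\<in>{1..n}. \<exists>x\<in>nbhd n d k. p k = c \<and> x \<noteq> k \<and> p x \<in> nbhd n d c')})"
  define E4 where "E4 = (\<lambda>c m'. {p. p permutes {1..n} \<and>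
    (\<exists>k\<in>{1..n}. \<exists>x\<in>nbhd n d k. p k = c \<and> x \<noteq> k \<and> x \<noteq> m' \<and> k \<noteq> m' \<and> p x \<in> nbhd n d (p m'))})"
  have ij: "i \<in> {1..n}" "j \<in> {1..n}"
    using q by (auto simp: close_quads_def)
  define D where "D = (2 * d + 1) ^ 2"
  obtain k where k: "n = k + 4" using n by (metis le_Suc_ex add.commute)
  have n12: "n - 1 = Suc (n - 2)" "n - 2 = Suc (n - 3)" using n by auto
  have f1: "fact (n - 1) = (n - 1) * fact (n - 2)" "fact (n - 2) = (n - 2) * fact (n - 3)"
    using fact_Suc[of "n - 2", where 'a = nat] fact_Suc[of "n - 3", where 'a = nat]
    unfolding n12[symmetric] by simp_all
  have f2: "n * fact (n - 2) \<le> 2 * fact (n - 1)"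
  proof -
    have "n * fact (n - 2) \<le> (2 * (n - 1)) * fact (n - 2)"
      using n by (intro mult_right_mono) auto
    then show ?thesis using f1(1) by (simp only: mult.assoc)
  qed
  \<comment> \<open>Here \<open>n \<ge> 4\<close> enters: it gives
    \<open>n \<le> 2 * (n - 1)\<close> and \<open>n \<le> 2 * (n - 2)\<close>.\<close>
  have f3: "n ^ 2 * fact (n - 3) \<le> 4 * fact (n - 1)"
  proof -
    have "n ^ 2 \<le> 4 * ((n - 1) * (n - 2))"
      by (simp add: k power2_eq_square algebra_simps)
    then have "n ^ 2 * fact (n - 3) \<le> (4 * ((n - 1) * (n - 2))) * fact (n - 3)"
      by (intro mult_right_mono) auto
    then show ?thesis using f1 by (simp only: mult.assoc)
  qed
  let ?E = "(\<Union>(m, c)\<in>{i, j} \<times> {a, b}. E1 m c) \<union> (\<Union>(m, m')\<in>{i, j} \<times> {i, j}. E2 m m') \<union>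
    (\<Union>(c, c')\<in>{a, b} \<times> {a, b}. E3 c c') \<union> (\<Union>(c, m)\<in>{a, b} \<times> {i, j}. E4 c m)"
  have c4: "card ({x, y} \<times> {z, w}) \<le> 4" for x y z w :: nat
    unfolding card_cartesian_product using mult_mono[of "card {x, y}" 2 "card {z, w}" 2]
    by (simp add: card_insert_if)
  have U: "card (\<Union>t\<in>{x, y} \<times> {z, w}. F t) \<le> 4 * B"
    if "\<And>t. t \<in> {x, y} \<times> {z, w} \<Longrightarrow> card (F t) \<le> B" for x y z w B and F :: "nat \<times> nat \<Rightarrow> (nat \<Rightarrow> nat) set"
  proof -
    have "card (\<Union>t\<in>{x, y} \<times> {z, w}. F t) \<le> card ({x, y} \<times> {z, w}) * B"
      by (rule card_UN_le_mult) (use that in auto)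
    also have "\<dots> \<le> 4 * B" by (intro mult_right_mono c4) auto
    finally show ?thesis .
  qed
  have 1: "card (\<Union>(m, c)\<in>{i, j} \<times> {a, b}. E1 m c) \<le> 4 * (D * fact (n - 1))"
    by (rule U, clarify) (simp only: E1_def D_def card_nbhd_to_nbhd_le)
  have 2: "card (\<Union>(m, m')\<in>{i, j} \<times> {i, j}. E2 m m') \<le> 4 * (D * (2 * fact (n - 1)))"
  proof (rule U, clarify)
    fix m m' assume "m' \<in> {i, j}"
    then have "card (E2 m m') \<le> D * n * fact (n - 2)"
      unfolding E2_def D_def by (intro card_nbhd_to_nbhd_image_le) (use n ij in auto)
    also have "\<dots> \<le> D * (2 * fact (n - 1))"
      unfolding mult.assoc by (intro mult_left_mono f2) auto
    finally show "card (E2 m m') \<le> D * (2 * fact (n - 1))" .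
  qed
  have 3: "card (\<Union>(c, c')\<in>{a, b} \<times> {a, b}. E3 c c') \<le> 4 * (D * (2 * fact (n - 1)))"
  proof (rule U, clarify)
    fix c c'
    have "card (E3 c c') \<le> D * n * fact (n - 2)"
      unfolding E3_def D_def by (rule card_nbhd_preimage_to_nbhd_le)
    also have "\<dots> \<le> D * (2 * fact (n - 1))"
      unfolding mult.assoc by (intro mult_left_mono f2) auto
    finally show "card (E3 c c') \<le> D * (2 * fact (n - 1))" .
  qed
  have 4: "card (\<Union>(c, m)\<in>{a, b} \<times> {i, j}. E4 c m) \<le> 4 * (D * (4 * fact (n - 1)))"
  proof (rule U, clarify)
    fix c m assume "m \<in> {i, j}"
    then have "card (E4 c m) \<le> D * n ^ 2 * fact (n - 3)"
      unfolding E4_def D_def by (intro card_nbhd_preimage_to_nbhd_image_le) (use n ij in auto)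
    also have "\<dots> \<le> D * (4 * fact (n - 1))"
      unfolding mult.assoc by (intro mult_left_mono f3) auto
    finally show "card (E4 c m) \<le> D * (4 * fact (n - 1))" .
  qed
  have "card ?E \<le> 4 * (D * fact (n - 1)) + 4 * (D * (2 * fact (n - 1))) +
      4 * (D * (2 * fact (n - 1))) + 4 * (D * (4 * fact (n - 1)))"
    by (intro order_trans[OF card_Un_le] add_mono 1 2 3 4)
  then have cE: "card ?E \<le> 36 * D * fact (n - 1)" by simp
  have "finite ?E"
    by (rule finite_subset[OF _ finite_permutations[of "{1..n}"]])
       (auto simp: E1_def E2_def E3_def E4_def)
  moreover have "{p. p permutes {1..n} \<and>
      card (close_pairs n d (prescribe_two i j a b p)) \<noteq> Suc (card (close_pairs n d p))} \<subseteq> ?E"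
  proof (rule subsetI, rule ccontr)
    fix p assume "p \<in> {p. p permutes {1..n} \<and>
        card (close_pairs n d (prescribe_two i j a b p)) \<noteq> Suc (card (close_pairs n d p))}"
      and nE: "p \<notin> ?E"
    then have p: "p permutes {1..n}"
      and bad: "card (close_pairs n d (prescribe_two i j a b p)) \<noteq> Suc (card (close_pairs n d p))"
      by auto
    have nE1: "p \<notin> E1 m c" if "m \<in> {i, j}" "c \<in> {a, b}" for m c
    proof
      assume "p \<in> E1 m c"
      then have "p \<in> (\<Union>(m, c)\<in>{i, j} \<times> {a, b}. E1 m c)"
        using that by (intro UN_I[of "(m, c)"] SigmaI) simp_all
      then show False using nE by (simp only: Un_iff simp_thms)
    qed
    have nE2: "p \<notin> E2 m c" if "m \<in> {i, j}" "c \<in> {i, j}" for m c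
    proof
      assume "p \<in> E2 m c"
      then have "p \<in> (\<Union>(m, c)\<in>{i, j} \<times> {i, j}. E2 m c)"
        using that by (intro UN_I[of "(m, c)"] SigmaI) simp_all
      then show False using nE by (simp only: Un_iff simp_thms)
    qed
    have nE3: "p \<notin> E3 m c" if "m \<in> {a, b}" "c \<in> {a, b}" for m c
    proof
      assume "p \<in> E3 m c"
      then have "p \<in> (\<Union>(m, c)\<in>{a, b} \<times> {a, b}. E3 m c)"
        using that by (intro UN_I[of "(m, c)"] SigmaI) simp_all
      then show False using nE by (simp only: Un_iff simp_thms)
    qed
    have nE4: "p \<notin> E4 m c" if "m \<in> {a, b}" "c \<in> {i, j}" for m c
    proof
      assume "p \<in> E4 m c"
      then have "p \<in> (\<Union>(m, c)\<in>{a, b} \<times> {i, j}. E4 m c)"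
        using that by (intro UN_I[of "(m, c)"] SigmaI) simp_all
      then show False using nE by (simp only: Un_iff simp_thms)
    qed
    have "card (close_pairs n d (prescribe_two i j a b p)) = Suc (card (close_pairs n d p))"
    proof (rule card_close_pairs_prescribe_two[OF p q])
      fix m c x assume "m \<in> {i, j}" "c \<in> {a, b}" "x \<in> nbhd n d m"
      with nE1[of m c] p show "p x \<notin> nbhd n d c" unfolding E1_def by blast
    next
      fix m m' x assume "m \<in> {i, j}" "m' \<in> {i, j}" "x \<in> nbhd n d m" "x \<noteq> m'"
      with nE2[of m m'] p show "p x \<notin> nbhd n d (p m')" unfolding E2_def by blast
    next
      fix c c' k x assume "c \<in> {a, b}" "c' \<in> {a, b}" "k \<in> {1..n}" "p k = c" "x \<in> nbhd n d k" "x \<noteq> k"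
      with nE3[of c c'] p show "p x \<notin> nbhd n d c'" unfolding E3_def by blast
    next
      fix c m' k x assume "c \<in> {a, b}" "m' \<in> {i, j}" "k \<in> {1..n}" "p k = c" "x \<in> nbhd n d k" "x \<noteq> k"
        "x \<noteq> m'" "k \<noteq> m'"
      with nE4[of c m'] p show "p x \<notin> nbhd n d (p m')" unfolding E4_def by blast
    qed
    with bad show False by blast
  qed
  ultimately show ?thesis
    using cE unfolding D_def by (meson card_mono order_trans)
qed

section \<open>Numerical estimates and the asymptotic statement\<close>

text \<open>Used to replace the exact mean of \<open>W\<close> by \<open>d ^ 2 + d\<close>. Factor
  out the larger exponential, which is at most 1, and apply
  \<open>1 + z \<le> exp z\<close>.\<close>

lemma abs_exp_minus_diff_le:
  fixes x y :: real
  assumes "x \<ge> 0" "y \<ge> 0"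
  shows "\<bar>exp (- x) - exp (- y)\<bar> \<le> \<bar>x - y\<bar>"
proof -
  have *: "\<bar>exp (- x) - exp (- y)\<bar> \<le> y - x" if "0 \<le> x" "x \<le> y" for x y :: real
  proof -
    have "1 + (x - y) \<le> exp (x - y)" by (rule exp_ge_add_one_self)
    then have le: "1 - exp (x - y) \<le> y - x" by linarith
    have "exp (- y) = exp (- x) * exp (x - y)" by (simp flip: exp_add)
    then have "exp (- x) - exp (- y) = exp (- x) * (1 - exp (x - y))"
      by (simp add: algebra_simps)
    also have "\<dots> \<le> 1 * (y - x)"
      using that by (intro mult_mono le) auto
    finally show ?thesis using that by simp
  qed
  show ?thesis
    using *[of x y] *[of y x] assms by (cases "x \<le> y") (auto simp: abs_minus_commute)
qed

text \<open>The constant is 1296 + 4: the first part is the coupling error, the second the cost of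
  replacing the exact mean \<open>l'\<close> by \<open>l\<close>.\<close>

lemma no_close_pairs_prob:
  fixes n d :: nat
  assumes n: "n \<ge> 4" and d: "d \<ge> 1" "d \<le> n"
  shows "\<bar>real (card {p. p permutes {1..n} \<and> min_manhattan n p \<ge> d + 2})
               / real (card {p. p permutes {1..n}}) - exp (- (real d ^ 2 + real d))\<bar>
         \<le> 1300 * real d ^ 4 / real n"
proof -
  define l where "l = real d ^ 2 + real d"
  define c where "c = real (n * (n - 1))"
  define l' where "l' = real (card (close_quads n d)) / c"
  define B where "B = real (36 * (2 * d + 1) ^ 2 * fact (n - 1))"
  define \<Omega> where "\<Omega> = {p. p permutes {1..n}}"
  define W where "W = (\<lambda>p. card (close_pairs n d p))"
  have c0: "c > 0" using n by (simp add: c_def)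
  have c_eq: "c = real n * (real n - 1)" using n by (simp add: c_def of_nat_diff)
  have cO: "card \<Omega> = fact n" by (simp add: \<Omega>_def card_permutations)
  have "\<bar>real (card {p \<in> \<Omega>. W p = 0}) - real (card \<Omega>) * exp (- l')\<bar> \<le> l' * B"
    unfolding l'_def
  proof (rule chen_stein_coupling[where T = "\<lambda>(i, j, a, b). prescribe_two i j a b" and
        M = "\<lambda>(i, j, a, b). {p. p i = a \<and> p j = b}"])
    show "finite \<Omega>" by (simp add: \<Omega>_def finite_permutations)
    show "finite (close_quads n d)" by (rule finite_close_quads)
    show "c > 0" by (rule c0)
    show "W p = card {\<alpha> \<in> close_quads n d. p \<in> (case \<alpha> of (i, j, a, b) \<Rightarrow> {p. p i = a \<and> p j = b})}"
      if "p \<in> \<Omega>" for p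
      using that card_close_pairs by (simp add: \<Omega>_def W_def)
  next
    fix \<alpha> and f :: "(nat \<Rightarrow> nat) \<Rightarrow> real" assume q: "\<alpha> \<in> close_quads n d"
    obtain i j a b where \<alpha>: "\<alpha> = (i, j, a, b)" by (cases \<alpha>)
    have *: "i \<in> {1..n}" "j \<in> {1..n}" "i \<noteq> j" "a \<in> {1..n}" "b \<in> {1..n}" "a \<noteq> b"
      using q by (auto simp: \<alpha> close_quads_def)
    show "(\<Sum>p\<in>\<Omega>. f ((case \<alpha> of (i, j, a, b) \<Rightarrow> prescribe_two i j a b) p)) =
         c * sum f (\<Omega> \<inter> (case \<alpha> of (i, j, a, b) \<Rightarrow> {p. p i = a \<and> p j = b}))"
      using sum_permutes_prescribe_two[OF finite_atLeastAtMost *, of f]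
      unfolding \<Omega>_def c_def prescribe_two_def \<alpha> by simp
  next
    fix \<alpha> assume q: "\<alpha> \<in> close_quads n d"
    obtain i j a b where \<alpha>: "\<alpha> = (i, j, a, b)" by (cases \<alpha>)
    show "real (card {p \<in> \<Omega>. W ((case \<alpha> of (i, j, a, b) \<Rightarrow> prescribe_two i j a b) p) \<noteq> Suc (W p)}) \<le> B"
      using card_prescribe_two_bad_le[OF n, of i j a b] q
      unfolding \<Omega>_def W_def B_def \<alpha> by (simp only: of_nat_le_iff mem_Collect_eq prod.case)
  qed
  moreover have "{p \<in> \<Omega>. W p = 0} = {p. p permutes {1..n} \<and> min_manhattan n p \<ge> d + 2}"
    using n close_pairs_empty_iff[of n d]
    by (auto simp: \<Omega>_def W_def finite_close_pairs)
  ultimately have "\<bar>real (card {p. p permutes {1..n} \<and> min_manhattan n p \<ge> d + 2}) -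
      fact n * exp (- l')\<bar> \<le> l' * B"
    by (simp add: cO)
  then have "\<bar>real (card {p. p permutes {1..n} \<and> min_manhattan n p \<ge> d + 2}) - fact n * exp (- l')\<bar> / \<bar>fact n\<bar>
      \<le> l' * B / fact n"
    by (simp add: divide_right_mono)
  then have P: "\<bar>real (card {p. p permutes {1..n} \<and> min_manhattan n p \<ge> d + 2}) / fact n - exp (- l')\<bar>
      \<le> l' * B / fact n"
    unfolding abs_divide[symmetric] diff_divide_distrib by simp
  have d1: "real d \<ge> 1" and dn: "real d \<le> real n" and n4: "real n \<ge> 4" using d n by simp_all
  have l0: "l \<ge> 0" by (simp add: l_def)
  have l_le: "l \<le> 2 * real d ^ 2"
    using d1 by (simp add: l_def power2_eq_square)
  have l'0: "l' \<ge> 0" using c0 by (simp add: l'_def)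
  have "real (card (close_quads n d)) \<le> real (n ^ 2 * (d ^ 2 + d))"
    using card_close_quads_bounds(1) of_nat_mono by blast
  then have up: "real (card (close_quads n d)) \<le> real n ^ 2 * l"
    by (simp add: l_def)
  have "real ((n - d) ^ 2 * (d ^ 2 + d)) \<le> real (card (close_quads n d))"
    using card_close_quads_bounds(2) of_nat_mono by blast
  then have lo: "(real n - real d) ^ 2 * l \<le> real (card (close_quads n d))"
    using d by (simp add: l_def of_nat_diff)
  \<comment> \<open>The ratio of \<open>n ^ 2\<close> to \<open>n * (n - 1)\<close> is 1 + 1/(n -
    1), and 1/(n - 1) is at most 2/n.\<close>
  have "real n ^ 2 \<le> (1 + 2 / real n) * c"
    using n4 unfolding c_eq by (simp add: field_simps power2_eq_square)
  then have "real n ^ 2 * l \<le> (1 + 2 / real n) * c * l"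
    using l0 by (intro mult_right_mono)
  then have up': "l' \<le> (1 + 2 / real n) * l"
    using up c0 unfolding l'_def by (simp add: divide_le_eq mult_ac)
  have "(1 - 2 * real d / real n) * c \<le> (real n - real d) ^ 2"
  proof -
    have "(1 - 2 * real d / real n) * c = (real n - 2 * real d) * (real n - 1)"
      using n4 by (simp add: c_eq field_simps)
    also have "\<dots> \<le> (real n - real d) ^ 2"
    proof -
      have "(real n - real d) ^ 2 - (real n - 2 * real d) * (real n - 1) =
          (real d - 1) ^ 2 + (real n - 1)"
        by (simp add: power2_eq_square algebra_simps)
      also have "\<dots> \<ge> 0" using n4 by simp
      finally show ?thesis by simp
    qed
    finally show ?thesis .
  qed
  then have "(1 - 2 * real d / real n) * c * l \<le> (real n - real d) ^ 2 * l"
    using l0 by (intro mult_right_mono)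
  then have lo': "(1 - 2 * real d / real n) * l \<le> l'"
    using lo c0 unfolding l'_def by (simp add: le_divide_eq mult_ac)
  have "\<bar>l' - l\<bar> \<le> 2 * real d / real n * l"
  proof -
    have "2 / real n * l \<le> 2 * real d / real n * l"
      using d1 l0 n4 by (intro mult_right_mono divide_right_mono) auto
    then show ?thesis using up' lo' by (simp add: algebra_simps)
  qed
  also have "\<dots> \<le> 2 * real d / real n * (2 * real d ^ 2)"
    using n4 by (intro mult_left_mono l_le) auto
  also have "\<dots> = 4 * real d ^ 3 / real n"
    by (simp add: power2_eq_square power3_eq_cube)
  also have "\<dots> \<le> 4 * real d ^ 4 / real n"
    using d1 n4 by (intro divide_right_mono mult_left_mono power_increasing) auto
  finally have ll: "\<bar>l' - l\<bar> \<le> 4 * real d ^ 4 / real n" .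
  have "l' \<le> 4 * real d ^ 2"
  proof -
    have "(1 + 2 / real n) * l \<le> 2 * (2 * real d ^ 2)"
      using n4 l0 l_le by (intro mult_mono) auto
    then show ?thesis using up' by simp
  qed
  \<comment> \<open>From \<open>2 * d + 1 \<le> 3 * d\<close> the constant is 36 * 9 = 324;
    multiplied by the 4 in the bound for \<open>l'\<close> it gives 1296.\<close>
  moreover have "B / fact n \<le> 324 * real d ^ 2 / real n"
  proof -
    have "fact n = real n * fact (n - 1)" using n by (simp add: fact_reduce)
    then have "B / fact n = 36 * (2 * real d + 1) ^ 2 / real n"
      by (simp add: B_def)
    also have "\<dots> \<le> 36 * (3 * real d) ^ 2 / real n"
      using d1 by (intro divide_right_mono mult_left_mono power_mono) auto
    finally show ?thesis by (simp add: power_mult_distrib)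
  qed
  moreover have "0 \<le> B / fact n" by (simp add: B_def)
  ultimately have "l' * (B / fact n) \<le> (4 * real d ^ 2) * (324 * real d ^ 2 / real n)"
    using l'0 by (intro mult_mono) auto
  also have "\<dots> = 1296 * real d ^ 4 / real n"
    by (simp flip: power_add)
  finally have "l' * B / fact n \<le> 1296 * real d ^ 4 / real n" by simp
  with P ll abs_exp_minus_diff_le[OF l'0 l0]
  have "\<bar>real (card {p. p permutes {1..n} \<and> min_manhattan n p \<ge> d + 2}) / fact n - exp (- l)\<bar>
      \<le> 1296 * real d ^ 4 / real n + 4 * real d ^ 4 / real n"
    by linarith
  then show ?thesis
    using cO by (simp add: \<Omega>_def l_def add_divide_distrib[symmetric])
qed

theorem theorem1:
  fixes d :: "nat \<Rightarrow> nat"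
  assumes pos: "\<forall>n. d n \<ge> 1"
    and dlog: "(\<lambda>n. real (d n)) \<in> O(\<lambda>n. ln (real n))"
  shows "(\<lambda>n. real (card {p. p permutes {1..n} \<and> min_manhattan n p \<ge> d n + 2})
               / real (card {p. p permutes {1..n}})
             - exp (- (real (d n) ^ 2 + real (d n))))
         \<in> O(\<lambda>n. ln (real n) ^ 6 * exp (real (d n) ^ 2 + real (d n)) / real n)"
proof (rule bigoI[of _ 31200], rule eventually_mono[OF eventually_ge_at_top[of 4]])
  fix n :: nat assume n: "4 \<le> n"
  let ?P = "real (card {p. p permutes {1..n} \<and> min_manhattan n p \<ge> d n + 2})
               / real (card {p. p permutes {1..n}})"
  define l where "l = real (d n) ^ 2 + real (d n)"
  have d1: "d n \<ge> 1" using pos by blast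
  have "exp 1 \<le> real n" using exp_le n by linarith
  then have "1 \<le> ln (real n)"
    using n by (subst ln_ge_iff) auto
  then have ln1: "1 \<le> ln (real n) ^ 6" by (rule one_le_power)
  have l_ge: "real (d n) \<le> l" by (simp add: l_def)
  \<comment> \<open>The constant is 1300 * 24, where 24 comes from
    \<open>d ^ 4 \<le> 24 * exp d\<close>, the term of index 4 in the exponential series.\<close>
  have "\<bar>?P - exp (- l)\<bar> \<le> 31200 * (exp l / real n)"
  proof (cases "d n \<le> n")
    case True
    have exps: "(\<lambda>k. real (d n) ^ k / fact k) sums exp (real (d n))"
      using exp_converges[of "real (d n)"] by (simp add: field_simps scaleR_conv_of_real)
    have "(\<Sum>k\<in>{4}. real (d n) ^ k / fact k) \<le> (\<Sum>k. real (d n) ^ k / fact k)"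
      by (rule sum_le_suminf[OF sums_summable[OF exps]]) auto
    also have "\<dots> = exp (real (d n))" using sums_unique[OF exps] by simp
    also have "\<dots> \<le> exp l" using l_ge by simp
    finally have "real (d n) ^ 4 \<le> 24 * exp l" by (simp add: fact_numeral)
    then have "1300 * real (d n) ^ 4 / real n \<le> 1300 * (24 * exp l) / real n"
      by (intro divide_right_mono mult_left_mono) auto
    then show ?thesis
      using no_close_pairs_prob[OF n d1 True] by (simp add: l_def)
  next
    \<comment> \<open>For \<open>d n > n\<close> the bound is trivial: \<open>exp l\<close> exceeds
      \<open>n\<close>, while two numbers in [0, 1] differ by at most 1.\<close>
    case False
    have "real n \<le> exp l"
      using exp_ge_add_one_self[of l] l_ge False by linarith
    then have "1 \<le> exp l / real n" using n by simp
    moreover have "0 \<le> ?P" "?P \<le> 1"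
    proof -
      have "card {p. p permutes {1..n} \<and> min_manhattan n p \<ge> d n + 2} \<le> card {p. p permutes {1..n}}"
        by (intro card_mono finite_permutations) auto
      moreover have "0 < real (card {p. p permutes {1..n}})" by (simp add: card_permutations)
      ultimately show "?P \<le> 1" by (simp only: divide_le_eq_1_pos of_nat_le_iff)
    qed simp
    moreover have "0 \<le> exp (- l)" "exp (- l) \<le> 1" using l_ge by auto
    ultimately show ?thesis by linarith
  qed
  also have "\<dots> \<le> 31200 * (ln (real n) ^ 6 * (exp l / real n))"
    using mult_right_mono[OF ln1, of "exp l / real n"] by simp
  also have "\<dots> = 31200 * norm (ln (real n) ^ 6 * exp l / real n)"
    using ln1 by simp
  finally show "norm (?P - exp (- (real (d n) ^ 2 + real (d n))))
      \<le> 31200 * norm (ln (real n) ^ 6 * exp (real (d n) ^ 2 + real (d n)) / real n)"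
    by (simp add: l_def)
qed

end
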